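(* Let $X$ be a real normed space with $\dim X\ge 2$, let $\lambda\in\Lambda_m$ and $1\le p\le\infty$. Then $$J(X)\le 2^{1/p}\,\mathfrak{C}_{\lambda,p}(X),$$ where $2^{1/\infty}=1$. In particular, if $\mathfrak{C}_{\lambda,p}(X)<2^{1-1/p}$ for some $p\in[1,\infty]$, then $J(X)<2$.
   Context: $\Lambda$ is the class of all continuous functions $\lambda:[0,\infty)^2\to[0,\infty)$ that are homogeneous of degree one and satisfy $\lambda(1,1)=1$. $\Lambda_m$ is the set of $\lambda\in\Lambda$ that are non-decreasing in each variable. $S_X$ is the unit sphere of $X$. For $(r,s)\in\mathbb{R}^2$, $\|(r,s)\|_p=(|r|^p+|s|^p)^{1/p}$ if $1\le p<\infty$ and $\|(r,s)\|_\infty=\max\{|r|,|s|\}$. Define $$\mathfrak{C}_{\lambda,p}(X)=\sup\{\lambda(\|ru+sv\|,\|su-rv\|):u,v\in S_X,\ r,s\ge0,\ \|(r,s)\|_p=1\}.$$ The James constant is $J(X)=\sup\{\min\{\|x+y\|,\|x-y\|\}:x,y\in S_X\}$. *)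

theory Defs
  imports "HOL-Analysis.Analysis"
begin

(* Functions on the quadrant are modelled by total functions of which only the values on
   the quadrant matter. *)
definition quadrant :: "(real \<times> real) set" where
  "quadrant = {0..} \<times> {0..}"

definition Lambda :: "(real \<times> real \<Rightarrow> real) set" where
  "Lambda = {f. f \<in> quadrant \<rightarrow> {0..} \<and> continuous_on quadrant f \<and>
     (\<forall>t\<ge>0. \<forall>x\<in>quadrant. f (t *\<^sub>R x) = t * f x) \<and> f (1, 1) = 1}"

definition Lambda_m :: "(real \<times> real \<Rightarrow> real) set" where
  "Lambda_m = {f \<in> Lambda. (\<forall>b\<ge>0. mono_on {0..} (\<lambda>a. f (a, b))) \<and>
     (\<forall>a\<ge>0. mono_on {0..} (\<lambda>b. f (a, b)))}"

definition lp_norm :: "ereal \<Rightarrow> real \<times> real \<Rightarrow> real" where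
  "lp_norm p = (\<lambda>(r, s).
     if p = \<infinity> then max \<bar>r\<bar> \<bar>s\<bar>
     else (\<bar>r\<bar> powr real_of_ereal p + \<bar>s\<bar> powr real_of_ereal p) powr (1 / real_of_ereal p))"

(* The space X is the type 'a, passed as TYPE('a). The sets below are bounded (for the first,
   f is continuous on a compact square), so the real-valued Sup is the genuine supremum as soon
   as the unit sphere is nonempty. *)
definition C_const ::
    "'a::real_normed_vector itself \<Rightarrow> (real \<times> real \<Rightarrow> real) \<Rightarrow> ereal \<Rightarrow> real" where
  "C_const X f p = Sup {f (norm (r *\<^sub>R u + s *\<^sub>R v), norm (s *\<^sub>R u - r *\<^sub>R v)) | (u::'a) v r s.
     u \<in> sphere 0 1 \<and> v \<in> sphere 0 1 \<and> r \<ge> 0 \<and> s \<ge> 0 \<and> lp_norm p (r, s) = 1}"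

definition James :: "'a::real_normed_vector itself \<Rightarrow> real" where
  "James X = Sup {min (norm (x + y)) (norm (x - y)) | (x::'a) y.
     x \<in> sphere 0 1 \<and> y \<in> sphere 0 1}"

(* The library's dim is 0 in infinite dimension, hence this formulation. *)
definition dim_at_least :: "nat \<Rightarrow> 'a::real_vector itself \<Rightarrow> bool" where
  "dim_at_least n X \<longleftrightarrow> (\<exists>B::'a set. finite B \<and> card B = n \<and> independent B)"

end

theory Submission
  imports Defs
begin

text \<open>On the diagonal \<open>r = s = 2\<^sup>-\<^sup>1\<^sup>/\<^sup>p\<close> both arguments of \<open>\<lambda>\<close> are at least
  \<open>2\<^sup>-\<^sup>1\<^sup>/\<^sup>p min (\<parallel>u + v\<parallel>) (\<parallel>u - v\<parallel>)\<close>, and \<open>\<lambda> (t, t) = t\<close>, so monotonicity gives the bound.\<close>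

lemma Lambda_m_mono:
  assumes "f \<in> Lambda_m" "0 \<le> a" "a \<le> a'" "0 \<le> b" "b \<le> b'"
  shows "f (a, b) \<le> f (a', b')"
proof -
  have "f (a, b) \<le> f (a', b)"
    using assms unfolding Lambda_m_def mono_on_def by simp
  also have "\<dots> \<le> f (a', b')"
    using assms unfolding Lambda_m_def mono_on_def by simp
  finally show ?thesis .
qed

lemma Lambda_diagonal:
  assumes "f \<in> Lambda" "0 \<le> t"
  shows "f (t, t) = t"
proof -
  have "\<forall>t\<ge>0. \<forall>x\<in>quadrant. f (t *\<^sub>R x) = t * f x" and "f (1, 1) = 1"
    using assms(1) by (simp_all add: Lambda_def)
  moreover have "(1, 1) \<in> quadrant"
    by (simp add: quadrant_def)
  ultimately have "f (t *\<^sub>R (1, 1)) = t * 1"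
    using assms(2) by metis
  then show ?thesis
    by simp
qed

lemma ereal_ge_1_cases:
  assumes "1 \<le> (p::ereal)"
  obtains q where "p = ereal q" "1 \<le> q" | "p = \<infinity>"
  using assms by (cases p) auto

text \<open>For finite \<open>p\<close>, two nonnegative summands with sum 1 are each at most 1; for
  \<open>p = \<infinity>\<close> the maximum is 1. The bound on the coefficients serves to bound the
  set whose supremum is \<open>C_const\<close>.\<close>

lemma lp_norm_eq_1_imp_le:
  assumes "1 \<le> p" "lp_norm p (r, s) = 1"
  shows "\<bar>r\<bar> \<le> 1 \<and> \<bar>s\<bar> \<le> 1"
  using assms(1)
proof (cases p rule: ereal_ge_1_cases)
  case (1 q)
  define S where "S = \<bar>r\<bar> powr q + \<bar>s\<bar> powr q"
  have "S powr (1 / q) = 1"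
    using assms(2) 1 by (simp add: lp_norm_def S_def)
  then have "(S powr (1 / q)) powr q = 1"
    by simp
  \<comment> \<open>\<open>S powr 1 = S\<close> requires \<open>0 \<le> S\<close>, which becomes
    visible once \<open>S_def\<close> is unfolded.\<close>
  then have "S = 1"
    using 1 by (simp add: powr_powr S_def)
  then have "\<bar>r\<bar> powr q \<le> 1 \<and> \<bar>s\<bar> powr q \<le> 1"
    unfolding S_def by (smt (verit) powr_ge_zero)
  moreover have "x \<le> 1" if "x powr q \<le> 1" for x :: real
    using 1 that gr_one_powr[of x q] by linarith
  ultimately show ?thesis
    by blast
next
  case 2
  then show ?thesis
    using assms(2) by (auto simp: lp_norm_def max_def split: if_splits)
qed

text \<open>For finite \<open>p\<close> each of the two summands is 1/2. For
  \<open>p = \<infinity>\<close> the quotient \<open>1 / p\<close> is 0 in \<open>ereal\<close>, so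
  the point is (1, 1), of maximum norm 1.\<close>

lemma lp_norm_diagonal:
  assumes "1 \<le> p"
  shows "lp_norm p (2 powr - real_of_ereal (1 / p), 2 powr - real_of_ereal (1 / p)) = 1"
  using assms
proof (cases p rule: ereal_ge_1_cases)
  case (1 q)
  then show ?thesis
    by (simp add: lp_norm_def powr_powr one_ereal_def flip: powr_minus_divide)
next
  case 2
  then show ?thesis
    by (simp add: lp_norm_def)
qed

text \<open>A real \<open>Sup\<close> is sure to dominate the members of its set only if the set is
  bounded above. Monotonicity of \<open>f\<close> turns bounds on the two norms into a bound on the
  values.\<close>

lemma C_const_upper:
  fixes u v :: "'a::real_normed_vector"
  assumes f: "f \<in> Lambda_m" and p: "1 \<le> p"
    and "norm u = 1" "norm v = 1" "0 \<le> r" "0 \<le> s" "lp_norm p (r, s) = 1"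
  shows "f (norm (r *\<^sub>R u + s *\<^sub>R v), norm (s *\<^sub>R u - r *\<^sub>R v)) \<le> C_const TYPE('a) f p"
  unfolding C_const_def
proof (rule cSup_upper)
  show "bdd_above {f (norm (r *\<^sub>R u + s *\<^sub>R v), norm (s *\<^sub>R u - r *\<^sub>R v)) | (u::'a) v r s.
     u \<in> sphere 0 1 \<and> v \<in> sphere 0 1 \<and> r \<ge> 0 \<and> s \<ge> 0 \<and> lp_norm p (r, s) = 1}"
  \<comment> \<open>Each 2 comes from the triangle inequality for two unit vectors with coefficients
    in [0, 1].\<close>
  proof (rule bdd_aboveI[of _ "f (2, 2)"], clarify)
    fix u v :: 'a and r s :: real
    assume uv: "u \<in> sphere 0 1" "v \<in> sphere 0 1" and rs: "0 \<le> r" "0 \<le> s"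
      and "lp_norm p (r, s) = 1"
    then have "r \<le> 1" "s \<le> 1"
      using lp_norm_eq_1_imp_le[OF p] by fastforce+
    then have "norm (r *\<^sub>R u + s *\<^sub>R v) \<le> 2" "norm (s *\<^sub>R u - r *\<^sub>R v) \<le> 2"
      using uv rs norm_triangle_ineq[of "r *\<^sub>R u" "s *\<^sub>R v"]
        norm_triangle_ineq4[of "s *\<^sub>R u" "r *\<^sub>R v"] by auto
    then show "f (norm (r *\<^sub>R u + s *\<^sub>R v), norm (s *\<^sub>R u - r *\<^sub>R v)) \<le> f (2, 2)"
      by (intro Lambda_m_mono[OF f]) auto
  qed
qed (use assms in auto)

lemma min_norm_le_C_const:
  fixes u v :: "'a::real_normed_vector"
  assumes f: "f \<in> Lambda_m" and p: "1 \<le> p" and uv: "norm u = 1" "norm v = 1"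
  shows "min (norm (u + v)) (norm (u - v)) \<le> 2 powr real_of_ereal (1 / p) * C_const TYPE('a) f p"
proof -
  define c where "c = 2 powr - real_of_ereal (1 / p)"
  define m where "m = min (norm (u + v)) (norm (u - v))"
  have c: "c > 0"
    by (simp add: c_def)
  have n: "norm (c *\<^sub>R u + c *\<^sub>R v) = c * norm (u + v)" "norm (c *\<^sub>R u - c *\<^sub>R v) = c * norm (u - v)"
    using c by (simp_all flip: scaleR_add_right scaleR_diff_right)
  have "c * m = f (c * m, c * m)"
    using f c by (intro Lambda_diagonal[symmetric]) (auto simp: Lambda_m_def m_def)
  also have "\<dots> \<le> f (norm (c *\<^sub>R u + c *\<^sub>R v), norm (c *\<^sub>R u - c *\<^sub>R v))"
    unfolding n using c by (intro Lambda_m_mono[OF f]) (auto simp: m_def)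
  also have "\<dots> \<le> C_const TYPE('a) f p"
    using c lp_norm_diagonal[OF p] by (intro C_const_upper[OF f p uv]) (auto simp: c_def)
  \<comment> \<open>\<open>c\<close> is the reciprocal of
    \<open>2 powr real_of_ereal (1 / p)\<close>, so it moves across as that factor.\<close>
  finally show ?thesis
    by (simp add: c_def m_def powr_minus field_simps)
qed

text \<open>A member of an independent set is nonzero, and \<open>sgn\<close> normalises it. The
  dimension hypothesis thus makes the set under \<open>James\<close> nonempty, as
  \<open>cSup_least\<close> demands.\<close>

lemma dim_at_least_2_imp_unit_vector:
  assumes "dim_at_least 2 TYPE('a::real_normed_vector)"
  obtains x :: "'a::real_normed_vector" where "norm x = 1"
proof -
  obtain B :: "'a set" where B: "card B = 2" "independent B"
    using assms unfolding dim_at_least_def by blast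
  from B(1) have "B \<noteq> {}"
    by auto
  then obtain b where "b \<in> B"
    by blast
  then have "b \<noteq> 0"
    using B(2) dependent_zero by metis
  then have "norm (sgn b) = 1"
    by (simp add: norm_sgn)
  then show ?thesis
    using that by blast
qed

theorem proposition7:
  fixes f :: "real \<times> real \<Rightarrow> real"
  assumes "dim_at_least 2 TYPE('a::real_normed_vector)"
    and "f \<in> Lambda_m"
  shows "(\<forall>p::ereal. 1 \<le> p \<longrightarrow>
            James TYPE('a) \<le> 2 powr real_of_ereal (1 / p) * C_const TYPE('a) f p) \<and>
         ((\<exists>p::ereal. 1 \<le> p \<and> C_const TYPE('a) f p < 2 powr real_of_ereal (1 - 1 / p)) \<longrightarrow>
            James TYPE('a) < 2)"
proof -
  obtain x :: 'a where x: "norm x = 1"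
    using dim_at_least_2_imp_unit_vector[OF assms(1)] .
  have bound: "James TYPE('a) \<le> 2 powr real_of_ereal (1 / p) * C_const TYPE('a) f p"
    if p: "1 \<le> p" for p
    unfolding James_def
  proof (rule cSup_least)
    show "{min (norm (x + y)) (norm (x - y)) | (x::'a) y. x \<in> sphere 0 1 \<and> y \<in> sphere 0 1} \<noteq> {}"
      using x by auto
  qed (use min_norm_le_C_const[OF assms(2) p] in auto)
  moreover have "James TYPE('a) < 2"
    if p: "1 \<le> p" and C: "C_const TYPE('a) f p < 2 powr real_of_ereal (1 - 1 / p)" for p
  proof -
    \<comment> \<open>\<open>real_of_ereal\<close> sends infinite values to 0, so it need not
      respect subtraction; here \<open>1 / p\<close> is finite, being 0 at
      \<open>p = \<infinity>\<close>.\<close>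
    have exponent: "real_of_ereal (1 - 1 / p) = 1 - real_of_ereal (1 / p)"
      using p by (cases p rule: ereal_ge_1_cases) (auto simp: one_ereal_def)
    have "James TYPE('a) \<le> 2 powr real_of_ereal (1 / p) * C_const TYPE('a) f p"
      by (rule bound[OF p])
    \<comment> \<open>The positive factor keeps the inequality strict, and the two exponents add up
      to 1.\<close>
    also have "\<dots> < 2 powr real_of_ereal (1 / p) * 2 powr real_of_ereal (1 - 1 / p)"
      using C by simp
    also have "\<dots> = 2"
      unfolding exponent by (simp flip: powr_add)
    finally show ?thesis .
  qed
  ultimately show ?thesis
    by blast
qed

end
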